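(* Consider the interconnection of $n$ dynamical systems $\dot x_i=f_i(t,x_i,x_{-i})$, $i\in\{1,\dots,n\}$, where $x_i\in\mathbb{R}^{N_i}$, $N=\sum_{i=1}^nN_i$, $x_{-i}\in\mathbb{R}^{N-N_i}$ collects all $x_j$ with $j\ne i$, and $f_i:\mathbb{R}_{\ge0}\times\mathbb{R}^{N_i}\times\mathbb{R}^{N-N_i}\to\mathbb{R}^{N_i}$ is continuous. For each $i$, let $\|\cdot\|_i$ be a norm on $\mathbb{R}^{N_i}$ with compatible weak pairing $[\![\cdot,\cdot]\!]_i$ satisfying Deimling's inequality and the curve norm derivative formula. Assume there are constants $c_i>0$ and $\gamma_{ij}\ge0$ ($i\neq j$) such that, for every $i$: (C1) at each fixed $x_{-i}$ and $t$, the map $x_i\mapsto f_i(t,x_i,x_{-i})$ satisfies $\operatorname{osL}(f_i(t,\cdot,x_{-i}))\le -c_i<0$ with respect to $[\![\cdot,\cdot]\!]_i$; (C2) at each fixed $x_i$ and $t$, for all $x_{-i},y_{-i}\in\mathbb{R}^{N-N_i}$, $\|f_i(t,x_i,x_{-i})-f_i(t,x_i,y_{-i})\|_i\le\sum_{j=1,j\ne i}^n\gamma_{ij}\|x_j-y_j\|_j$. Define the gain matrix $\Gamma\in\mathbb{R}^{n\times n}$ by $\Gamma_{ii}=-c_i$ and $\Gamma_{ij}=\gamma_{ij}$ for $i\ne j$. If $\Gamma$ is Hurwitz, then (i) for every $\varepsilon\in\,]0,|\alpha(\Gamma)|[$, there exists $\xi\in\mathbb{R}_{>0}^n$ such that the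 interconnected system is strongly contracting with respect to $\|\cdot\|_\xi$ with rate $|\alpha(\Gamma)+\varepsilon|$; and (ii) if $\Gamma$ is irreducible, the result (i) holds with $\varepsilon=0$.
   Context: A weak pairing on $\mathbb{R}^m$ is a map $[\![\cdot,\cdot]\!]:\mathbb{R}^m\times\mathbb{R}^m\to\mathbb{R}$ such that: (1) $[\![x_1+x_2,y]\!]\le[\![x_1,y]\!]+[\![x_2,y]\!]$ for all $x_1,x_2,y$, and it is continuous in its first argument; (2) $[\![\alpha x,y]\!]=[\![x,\alpha y]\!]=\alpha[\![x,y]\!]$ for all $x,y$ and all $\alpha\ge 0$, and $[\![-x,-y]\!]=[\![x,y]\!]$; (3) $[\![x,x]\!]>0$ for all $x\ne 0$; (4) $|[\![x,y]\!]|\le[\![x,x]\!]^{1/2}[\![y,y]\!]^{1/2}$ for all $x,y$. It is compatible with the norm $\|\cdot\|$ if $[\![x,x]\!]=\|x\|^2$ for all $x$. It satisfies Deimling's inequality if $[\![x,y]\!]\le\|y\|\lim_{h\to0^+}\frac{\|y+hx\|-\|y\|}{h}$ for all $x,y$. It satisfies the curve norm derivative formula if, for every differentiable $x:\,]a,b[\,\to\mathbb{R}^m$ and almost every $t\in\,]a,b[$, $\|x(t)\|D^+\|x(t)\|=[\![\dot x(t),x(t)]\!]$, where $D^+\varphi(t)=\limsup_{h\to0^+}\frac{\varphi(t+h)-\varphi(t)}{h}$. For a map $g:\mathbb{R}^m\to\mathbb{R}^m$, $\operatorname{osL}(g)=\sup_{x\ne y}\frac{[\![g(x)-g(y),x-y]\!]}{\|x-y\|^2}\in\mathbb{R}\cup\{\infty\}$.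 $\alpha(\Gamma)$ is the spectral abscissa (maximum real part of the eigenvalues); $\Gamma$ is Hurwitz if $\alpha(\Gamma)<0$. For $\xi\in\mathbb{R}_{>0}^n$, $\|(x_1,\dots,x_n)\|_\xi^2=\sum_{i=1}^n\xi_i\|x_i\|_i^2$ is a norm on $\mathbb{R}^N$ and $[\![(x_1,\dots,x_n),(y_1,\dots,y_n)]\!]_\xi=\sum_{i=1}^n\xi_i[\![x_i,y_i]\!]_i$ is the corresponding weak pairing. A vector field $F(t,x)$ on $\mathbb{R}^N$ is strongly contracting with respect to $\|\cdot\|_\xi$ with rate $r>0$ if $\operatorname{osL}(F(t,\cdot))\le -r$ with respect to $[\![\cdot,\cdot]\!]_\xi$ for all $t\ge0$. *)

theory Defs
  imports "HOL-Analysis.Analysis" "HOL-Analysis.Finite_Function_Topology"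
begin

text \<open>
  The dimensions of the subsystems differ, so each coordinate space is realised as a subspace of
  one real normed vector space: the space of dimension \<open>m\<close> consists of the finitely supported real
  sequences with support in \<open>{..<m}\<close>. Being finite-dimensional, it inherits the usual topology.
  The product of these spaces over the finite index type \<open>'n\<close> is a subspace of \<open>fseq ^ 'n\<close>.
\<close>

type_synonym fseq = "nat \<Rightarrow>\<^sub>0 real"

definition Rn :: "nat \<Rightarrow> fseq set" where
  "Rn m = {x. Poly_Mapping.keys x \<subseteq> {..<m}}"

definition state_space :: "('n::finite \<Rightarrow> nat) \<Rightarrow> (fseq ^ 'n) set" where
  "state_space N = {x. \<forall>i. x $ i \<in> Rn (N i)}"

text \<open>
  A tuple of all components except the \<open>i\<close>-th is encoded as a full tuple whose \<open>i\<close>-th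
  component is zero.
\<close>

definition others_space :: "('n::finite \<Rightarrow> nat) \<Rightarrow> 'n \<Rightarrow> (fseq ^ 'n) set" where
  "others_space N i = {z \<in> state_space N. z $ i = 0}"

definition others :: "'n::finite \<Rightarrow> fseq ^ 'n \<Rightarrow> fseq ^ 'n" where
  "others i x = (\<chi> j. if j = i then 0 else x $ j)"

lemma subspace_Rn: "subspace (Rn m)"
proof -
  have eq: "x \<in> Rn m \<longleftrightarrow> (\<forall>k\<ge>m. Poly_Mapping.lookup x k = 0)" for x
    unfolding Rn_def in_keys_iff subset_iff mem_Collect_eq lessThan_iff
    by (meson not_less)
  have [simp]: "Poly_Mapping.lookup (c *\<^sub>R x) k = c * Poly_Mapping.lookup x k" for c k and x :: fseq
  proof -
    have "finite {i. c *\<^sub>R Poly_Mapping.lookup x i \<noteq> 0}"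
      by (rule finite_subset[OF _ finite_keys[of x]]) (auto simp: in_keys_iff)
    then show ?thesis
      by (simp add: scaleR_poly_mapping_def Abs_poly_mapping_inverse)
  qed
  show ?thesis
    by (simp add: subspace_def eq lookup_add)
qed

lemma subspace_state_space: "subspace (state_space N)"
  using subspace_Rn by (simp add: subspace_def state_space_def)

lemma others_in_others_space: "x \<in> state_space N \<Longrightarrow> others i x \<in> others_space N i"
  by (simp add: others_space_def others_def state_space_def subspace_0[OF subspace_Rn])


definition norm_on :: "'a::real_normed_vector set \<Rightarrow> ('a \<Rightarrow> real) \<Rightarrow> bool" where
  "norm_on V nrm \<longleftrightarrow>
     (\<forall>x\<in>V. nrm x \<ge> 0 \<and> (nrm x = 0 \<longleftrightarrow> x = 0)) \<and>
     (\<forall>x\<in>V. \<forall>a. nrm (a *\<^sub>R x) = \<bar>a\<bar> * nrm x) \<and>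
     (\<forall>x\<in>V. \<forall>y\<in>V. nrm (x + y) \<le> nrm x + nrm y)"

definition weak_pairing_on :: "'a::real_normed_vector set \<Rightarrow> ('a \<Rightarrow> 'a \<Rightarrow> real) \<Rightarrow> bool" where
  "weak_pairing_on V wp \<longleftrightarrow>
     (\<forall>x1\<in>V. \<forall>x2\<in>V. \<forall>y\<in>V. wp (x1 + x2) y \<le> wp x1 y + wp x2 y) \<and>
     (\<forall>y\<in>V. continuous_on V (\<lambda>x. wp x y)) \<and>
     (\<forall>x\<in>V. \<forall>y\<in>V. \<forall>a\<ge>0. wp (a *\<^sub>R x) y = a * wp x y \<and> wp x (a *\<^sub>R y) = a * wp x y) \<and>
     (\<forall>x\<in>V. \<forall>y\<in>V. wp (- x) (- y) = wp x y) \<and>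
     (\<forall>x\<in>V. x \<noteq> 0 \<longrightarrow> wp x x > 0) \<and>
     (\<forall>x\<in>V. \<forall>y\<in>V. \<bar>wp x y\<bar> \<le> sqrt (wp x x) * sqrt (wp y y))"

definition compatible_on ::
  "'a::real_normed_vector set \<Rightarrow> ('a \<Rightarrow> real) \<Rightarrow> ('a \<Rightarrow> 'a \<Rightarrow> real) \<Rightarrow> bool" where
  "compatible_on V nrm wp \<longleftrightarrow> (\<forall>x\<in>V. wp x x = (nrm x)\<^sup>2)"

text \<open>The limit below exists for every norm, because the difference quotient is monotone in \<open>h\<close>.\<close>

definition deimling_on ::
  "'a::real_normed_vector set \<Rightarrow> ('a \<Rightarrow> real) \<Rightarrow> ('a \<Rightarrow> 'a \<Rightarrow> real) \<Rightarrow> bool" where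
  "deimling_on V nrm wp \<longleftrightarrow>
     (\<forall>x\<in>V. \<forall>y\<in>V.
        wp x y \<le> nrm y * Lim (at_right 0) (\<lambda>h. (nrm (y + h *\<^sub>R x) - nrm y) / h))"

definition upper_right_Dini :: "(real \<Rightarrow> real) \<Rightarrow> real \<Rightarrow> ereal" where
  "upper_right_Dini \<phi> t = Limsup (at_right 0) (\<lambda>h. ereal ((\<phi> (t + h) - \<phi> t) / h))"

definition curve_norm_derivative_on ::
  "'a::real_normed_vector set \<Rightarrow> ('a \<Rightarrow> real) \<Rightarrow> ('a \<Rightarrow> 'a \<Rightarrow> real) \<Rightarrow> bool" where
  "curve_norm_derivative_on V nrm wp \<longleftrightarrow>
     (\<forall>(a::real) b x x'.
        (\<forall>t\<in>{a<..<b}. x t \<in> V \<and> (x has_vector_derivative x' t) (at t)) \<longrightarrow>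
        (AE t in lebesgue. t \<in> {a<..<b} \<longrightarrow>
           ereal (nrm (x t)) * upper_right_Dini (\<lambda>s. nrm (x s)) t = ereal (wp (x' t) (x t))))"

definition osL ::
  "'a::real_normed_vector set \<Rightarrow> ('a \<Rightarrow> real) \<Rightarrow> ('a \<Rightarrow> 'a \<Rightarrow> real) \<Rightarrow> ('a \<Rightarrow> 'a) \<Rightarrow> ereal" where
  "osL V nrm wp g =
     (SUP (x, y) \<in> {(x, y). x \<in> V \<and> y \<in> V \<and> x \<noteq> y}.
        ereal (wp (g x - g y) (x - y) / (nrm (x - y))\<^sup>2))"

definition strongly_contracting ::
  "'a::real_normed_vector set \<Rightarrow> ('a \<Rightarrow> real) \<Rightarrow> ('a \<Rightarrow> 'a \<Rightarrow> real) \<Rightarrow>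
   (real \<Rightarrow> 'a \<Rightarrow> 'a) \<Rightarrow> real \<Rightarrow> bool" where
  "strongly_contracting V nrm wp F r \<longleftrightarrow> r > 0 \<and> (\<forall>t\<ge>0. osL V nrm wp (F t) \<le> ereal (- r))"

definition weighted_norm ::
  "real ^ 'n \<Rightarrow> ('n::finite \<Rightarrow> fseq \<Rightarrow> real) \<Rightarrow> fseq ^ 'n \<Rightarrow> real" where
  "weighted_norm \<xi> nrm x = sqrt (\<Sum>i\<in>UNIV. \<xi> $ i * (nrm i (x $ i))\<^sup>2)"

definition weighted_pairing ::
  "real ^ 'n \<Rightarrow> ('n::finite \<Rightarrow> fseq \<Rightarrow> fseq \<Rightarrow> real) \<Rightarrow> fseq ^ 'n \<Rightarrow> fseq ^ 'n \<Rightarrow> real" where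
  "weighted_pairing \<xi> wp x y = (\<Sum>i\<in>UNIV. \<xi> $ i * wp i (x $ i) (y $ i))"

definition interconnection ::
  "('n::finite \<Rightarrow> real \<Rightarrow> fseq \<Rightarrow> fseq ^ 'n \<Rightarrow> fseq) \<Rightarrow> real \<Rightarrow> fseq ^ 'n \<Rightarrow> fseq ^ 'n" where
  "interconnection f t x = (\<chi> i. f i t (x $ i) (others i x))"


definition gain_matrix :: "('n \<Rightarrow> real) \<Rightarrow> ('n \<Rightarrow> 'n \<Rightarrow> real) \<Rightarrow> real ^ 'n ^ 'n::finite" where
  "gain_matrix c \<gamma> = (\<chi> i j. if i = j then - c i else \<gamma> i j)"

definition eigenvalues :: "real ^ 'n ^ 'n::finite \<Rightarrow> complex set" where
  "eigenvalues A = {l. \<exists>v. v \<noteq> 0 \<and> map_matrix complex_of_real A *v v = l *s v}"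

definition spectral_abscissa :: "real ^ 'n ^ 'n::finite \<Rightarrow> real" where
  "spectral_abscissa A = Max (Re ` eigenvalues A)"

definition Hurwitz :: "real ^ 'n ^ 'n::finite \<Rightarrow> bool" where
  "Hurwitz A \<longleftrightarrow> spectral_abscissa A < 0"

text \<open>
  A matrix is reducible if a simultaneous permutation of rows and columns makes it block
  triangular with square diagonal blocks, i.e. if there is a nonempty proper index set \<open>S\<close>
  (the indices of one diagonal block) such that all entries with row in \<open>S\<close> and column
  outside \<open>S\<close> vanish.
\<close>

definition irreducible_matrix :: "real ^ 'n ^ 'n::finite \<Rightarrow> bool" where
  "irreducible_matrix A \<longleftrightarrow>
     \<not> (\<exists>S. S \<noteq> {} \<and> S \<noteq> UNIV \<and> (\<forall>i\<in>S. \<forall>j\<in>- S. A $ i $ j = 0))"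

end

theory Submission
  imports Defs
begin

text \<open>
  Write \<open>d\<^sub>i\<close> for the \<open>i\<close>-th norm of \<open>x\<^sub>i - y\<^sub>i\<close>. Changing first the own state and then the
  remaining states in \<open>f\<^sub>i\<close>, subadditivity and the Cauchy-Schwarz inequality of the weak pairing turn
  the two hypotheses on \<open>f\<^sub>i\<close> into a bound of the pairing of the \<open>i\<close>-th increment of the vector field
  with \<open>x\<^sub>i - y\<^sub>i\<close> by \<open>d\<^sub>i (\<Gamma> d)\<^sub>i\<close> (lemma \<open>interconnection_pairing_le\<close>). Contraction with rate \<open>-r\<close>
  in the weighted norm thus follows once the quadratic form of \<open>diag(\<xi>) \<Gamma>\<close> is at most
  \<open>r\<close> times that of \<open>diag(\<xi>)\<close>: a diagonal Lyapunov inequality.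

  For a matrix with nonnegative off-diagonal entries (a Metzler matrix) such weights come from a right
  and a left positive subeigenvector: if \<open>\<Gamma> v \<le> r v\<close> and \<open>\<Gamma>\<^sup>T w \<le> r w\<close> with \<open>v, w > 0\<close>, then
  \<open>\<xi>\<^sub>i = w\<^sub>i / v\<^sub>i\<close> works, by the inequality of arithmetic and geometric means applied to each
  product \<open>d\<^sub>i d\<^sub>j\<close> (lemma \<open>diagonal_Lyapunov_bound\<close>).

  Subeigenvectors are a weak form of Perron-Frobenius theory. In the irreducible case, Brouwer's
  theorem on the simplex gives a positive eigenvector; its eigenvalue is real, hence at most
  the spectral abscissa, whatever its exact value (lemma
  \<open>irreducible_Metzler_positive_eigenvector\<close>). In the general case a small
  constant is added to all entries, which makes the matrix irreducible; a compactness argument shows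
  that the eigenvalue of the perturbed matrix stays below any \<open>r\<close> above the spectral abscissa
  (lemma \<open>Metzler_positive_subeigenvector\<close>). The transpose has the same
  eigenvalues, so both vectors are available for the same \<open>r\<close>.
\<close>

section \<open>Eigenvalues\<close>

lemma mem_eigenvalues_iff_det:
  "l \<in> eigenvalues A \<longleftrightarrow> det (map_matrix complex_of_real A - mat l) = 0"
proof -
  let ?M = "map_matrix complex_of_real A - mat l"
  have "mat l *v v = l *s v" for v :: "complex ^ 'a"
    by (simp add: vec_eq_iff matrix_vector_mult_def mat_def if_distrib[of "\<lambda>x. x * _"] cong: if_cong)
  then have "l \<in> eigenvalues A \<longleftrightarrow> (\<exists>v. v \<noteq> 0 \<and> ?M *v v = 0)"
    by (simp add: eigenvalues_def matrix_vector_mult_diff_rdistrib)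
  also have "\<dots> \<longleftrightarrow> \<not> inj ((*v) ?M)"
    using vec.linear_inj_iff_eq_0[OF matrix_vector_mul_linear_gen, of ?M] by blast
  also have "\<dots> \<longleftrightarrow> det ?M = 0"
    using invertible_det_nz[of ?M] invertible_left_inverse[of ?M]
      matrix_left_invertible_injective[of ?M] by metis
  finally show ?thesis .
qed

lemma eigenvalues_transpose: "eigenvalues (transpose A) = eigenvalues A"
proof -
  have "map_matrix complex_of_real (transpose A) - mat l
      = transpose (map_matrix complex_of_real A - mat l)" for l
    by (auto simp: vec_eq_iff transpose_def mat_def)
  then show ?thesis
    unfolding set_eq_iff mem_eigenvalues_iff_det by simp
qed

text \<open>
  Compare the two sides of the eigenvector equation at a component of the eigenvector of
  largest modulus. The bound supplies a number that is not an eigenvalue.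
\<close>

lemma norm_eigenvalue_le:
  assumes "l \<in> eigenvalues A"
  shows "norm l \<le> (\<Sum>i\<in>UNIV. \<Sum>j\<in>UNIV. \<bar>A $ i $ j\<bar>)"
proof -
  obtain v where v: "v \<noteq> 0" "map_matrix complex_of_real A *v v = l *s v"
    using assms by (auto simp: eigenvalues_def)
  define m where "m = Max (range (\<lambda>i. norm (v $ i)))"
  have le: "norm (v $ j) \<le> m" for j
    unfolding m_def by (rule Max_ge) auto
  have "m \<in> range (\<lambda>i. norm (v $ i))"
    unfolding m_def by (rule Max_in) auto
  then obtain i where i: "m = norm (v $ i)" by blast
  have "m > 0"
  proof -
    obtain k where "v $ k \<noteq> 0" using v(1) by (auto simp: vec_eq_iff)
    then show ?thesis using le[of k] zero_less_norm_iff[of "v $ k"] by linarith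
  qed
  have "norm l * m = norm (\<Sum>j\<in>UNIV. complex_of_real (A $ i $ j) * v $ j)"
    using v(2) by (auto simp: vec_eq_iff matrix_vector_mult_def i norm_mult)
  also have "\<dots> \<le> (\<Sum>j\<in>UNIV. \<bar>A $ i $ j\<bar> * m)"
    by (intro sum_norm_le) (simp add: norm_mult mult_left_mono le)
  also have "\<dots> = (\<Sum>j\<in>UNIV. \<bar>A $ i $ j\<bar>) * m"
    by (simp add: sum_distrib_right)
  finally have "norm l \<le> (\<Sum>j\<in>UNIV. \<bar>A $ i $ j\<bar>)"
    using \<open>m > 0\<close> by simp
  also have "\<dots> \<le> (\<Sum>i\<in>UNIV. \<Sum>j\<in>UNIV. \<bar>A $ i $ j\<bar>)"
    by (intro member_le_sum[of i UNIV "\<lambda>i. \<Sum>j\<in>UNIV. \<bar>A $ i $ j\<bar>"]) (auto intro: sum_nonneg)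
  finally show ?thesis .
qed

text \<open>
  Eigenvalues are the roots of the characteristic polynomial. Finiteness matters because the
  spectral abscissa is a \<open>Max\<close>, which bounds its elements only on finite sets.
\<close>

lemma finite_eigenvalues: "finite (eigenvalues A)"
proof -
  define p where "p = det (\<chi> i j. [:complex_of_real (A $ i $ j), if i = j then -1 else 0:])"
  have p: "poly p l = det (map_matrix complex_of_real A - mat l)" for l
    unfolding p_def det_def poly_sum poly_mult poly_prod
    by (intro sum.cong refl arg_cong2[where f = "(*)"] prod.cong) (auto simp: of_int_poly mat_def)
  have roots: "eigenvalues A = {l. poly p l = 0}"
    by (auto simp: p mem_eigenvalues_iff_det)
  define C where "C = (\<Sum>i\<in>UNIV. \<Sum>j\<in>UNIV. \<bar>A $ i $ j\<bar>)"
  have "C \<ge> 0" unfolding C_def by (intro sum_nonneg) auto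
  have "norm (complex_of_real (C + 1)) > C"
    unfolding norm_of_real using \<open>C \<ge> 0\<close> by linarith
  then have "complex_of_real (C + 1) \<notin> eigenvalues A"
    using norm_eigenvalue_le[of "complex_of_real (C + 1)" A] unfolding C_def[symmetric] by linarith
  then have "poly p (complex_of_real (C + 1)) \<noteq> 0"
    unfolding roots by (rule contrapos_nn) (rule CollectI)
  then have "p \<noteq> 0"
    by (rule contrapos_nn) (erule ssubst, rule poly_0)
  then show ?thesis unfolding roots by (rule poly_roots_finite)
qed

lemma real_eigenvalue_le_spectral_abscissa:
  fixes A :: "real ^ 'n ^ 'n::finite"
  assumes "v \<noteq> 0" "A *v v = r *s v"
  shows "r \<le> spectral_abscissa A"
proof -
  let ?w = "\<chi> i. complex_of_real (v $ i)"
  have "?w \<noteq> 0" using assms(1) by (simp add: vec_eq_iff)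
  moreover have "map_matrix complex_of_real A *v ?w = complex_of_real r *s ?w"
  proof -
    have "complex_of_real ((A *v v) $ i) = complex_of_real ((r *s v) $ i)" for i
      using assms(2) by simp
    then show ?thesis
      by (simp add: vec_eq_iff matrix_vector_mult_def)
  qed
  ultimately have "complex_of_real r \<in> eigenvalues A"
    unfolding eigenvalues_def by blast
  then have "Re (complex_of_real r) \<in> Re ` eigenvalues A"
    by (rule imageI)
  then show ?thesis
    unfolding spectral_abscissa_def by (simp add: Max_ge finite_eigenvalues)
qed

section \<open>Positive subeigenvectors of Metzler matrices\<close>

definition prob_simplex :: "(real ^ 'n::finite) set" where
  "prob_simplex = {v. (\<forall>i. v $ i \<ge> 0) \<and> (\<Sum>i\<in>UNIV. v $ i) = 1}"

lemma compact_prob_simplex: "compact (prob_simplex :: (real ^ 'n::finite) set)"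
proof -
  have "closed (prob_simplex :: (real ^ 'n) set)"
    unfolding prob_simplex_def
    by (intro closed_Collect_conj closed_Collect_all closed_Collect_le closed_Collect_eq continuous_intros)
  moreover have "norm v \<le> 1" if "v \<in> prob_simplex" for v :: "real ^ 'n"
    using norm_le_l1_cart[of v] that by (simp add: prob_simplex_def)
  ultimately show ?thesis
    unfolding compact_eq_bounded_closed bounded_iff by blast
qed

lemma convex_prob_simplex: "convex (prob_simplex :: (real ^ 'n::finite) set)"
  unfolding convex_def prob_simplex_def
  by (auto simp: sum.distrib sum_distrib_left[symmetric])

lemma prob_simplex_nonempty: "prob_simplex \<noteq> ({} :: (real ^ 'n::finite) set)"
proof -
  have "(\<chi> i. 1 / real CARD('n)) \<in> (prob_simplex :: (real ^ 'n) set)"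
    by (simp add: prob_simplex_def)
  then show ?thesis by blast
qed

lemma prob_simplex_nonzero: "v \<in> prob_simplex \<Longrightarrow> v \<noteq> 0"
  by (auto simp: prob_simplex_def)

text \<open>
  A shift by a multiple \<open>s\<close> of the identity makes the matrix nonnegative with positive diagonal
  without changing its eigenvectors. The shifted matrix \<open>B\<close> kills no point of the simplex, so
  \<open>v \<mapsto> B v / \<sigma> v\<close>, with \<open>\<sigma> v\<close> the sum of the components of \<open>B v\<close>, maps the simplex continuously
  to itself, and a Brouwer fixed point is a nonnegative eigenvector. Its zero components form
  an index set that can only be empty when the matrix is irreducible.
\<close>

lemma irreducible_Metzler_positive_eigenvector:
  fixes A :: "real ^ 'n ^ 'n::finite"
  assumes Metzler: "\<And>i j. i \<noteq> j \<Longrightarrow> A $ i $ j \<ge> 0"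
    and irr: "irreducible_matrix A"
  obtains v r where "v \<in> prob_simplex" "\<And>i. v $ i > 0" "A *v v = r *s v"
proof -
  define s where "s = 1 + (\<Sum>i\<in>UNIV. \<bar>A $ i $ i\<bar>)"
  have s: "s + A $ i $ i > 0" for i
    using member_le_sum[of i UNIV "\<lambda>i. \<bar>A $ i $ i\<bar>"] by (simp add: s_def)
  define B where "B = A + mat s"
  have mat_s: "mat s *v v = s *s v" for v :: "real ^ 'n"
    by (simp add: vec_eq_iff matrix_vector_mult_def mat_def if_distrib[of "\<lambda>x. x * _"] cong: if_cong)
  have B_nonneg: "B $ i $ j \<ge> 0" for i j
    using Metzler[of i j] s[of i] by (auto simp: B_def mat_def)
  have B_diag: "B $ i $ i > 0" for i
    using s[of i] by (simp add: B_def mat_def add.commute)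
  have Bv_nonneg: "(B *v v) $ i \<ge> 0" if "v \<in> prob_simplex" for v i
    using that B_nonneg by (auto simp: matrix_vector_mult_def prob_simplex_def intro!: sum_nonneg)
  define \<sigma> where "\<sigma> v = (\<Sum>i\<in>UNIV. (B *v v) $ i)" for v
  have \<sigma>_pos: "\<sigma> v > 0" if v: "v \<in> prob_simplex" for v
  proof -
    obtain k where k: "v $ k \<noteq> 0"
      using prob_simplex_nonzero[OF v] by (auto simp: vec_eq_iff)
    with v have "v $ k > 0"
      by (metis (mono_tags, lifting) mem_Collect_eq order_le_less prob_simplex_def)
    then have "0 < B $ k $ k * v $ k"
      using B_diag by simp
    also have "\<dots> \<le> (B *v v) $ k"
      unfolding matrix_vector_mult_def using v B_nonneg
      by (auto simp: prob_simplex_def intro!: member_le_sum[of k UNIV "\<lambda>j. B $ k $ j * v $ j"])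
    also have "\<dots> \<le> \<sigma> v"
      unfolding \<sigma>_def using Bv_nonneg[OF v] by (intro member_le_sum) auto
    finally show ?thesis .
  qed
  define \<phi> where "\<phi> v = (1 / \<sigma> v) *s (B *v v)" for v
  have "continuous_on prob_simplex \<phi>"
    unfolding \<phi>_def \<sigma>_def matrix_vector_mult_def vector_scalar_mult_def
    using \<sigma>_pos[unfolded \<sigma>_def matrix_vector_mult_def]
    by (intro continuous_intros) fastforce+
  moreover have "\<phi> \<in> prob_simplex \<rightarrow> prob_simplex"
  proof
    fix v :: "real ^ 'n" assume v: "v \<in> prob_simplex"
    have "(\<Sum>i\<in>UNIV. \<phi> v $ i) = (1 / \<sigma> v) * \<sigma> v"
      by (simp add: \<phi>_def \<sigma>_def sum_divide_distrib[symmetric])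
    then show "\<phi> v \<in> prob_simplex"
      using \<sigma>_pos[OF v] Bv_nonneg[OF v] by (simp add: prob_simplex_def \<phi>_def)
  qed
  ultimately obtain v where v: "v \<in> prob_simplex" and fix_v: "\<phi> v = v"
    using brouwer[OF compact_prob_simplex convex_prob_simplex prob_simplex_nonempty] by blast
  have Bv: "B *v v = \<sigma> v *s v"
  proof -
    have "\<sigma> v *s \<phi> v = B *v v"
      using \<sigma>_pos[OF v] by (simp add: \<phi>_def)
    then show ?thesis by (simp add: fix_v)
  qed
  \<comment> \<open>For \<open>i\<close> in \<open>S\<close>, row \<open>i\<close> of \<open>B v = \<sigma> v v\<close> is a vanishing sum of nonnegative terms.\<close>
  define S where "S = {i. v $ i = 0}"
  have "A $ i $ j = 0" if "i \<in> S" "j \<in> - S" for i j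
  proof -
    have "(\<Sum>k\<in>UNIV. B $ i $ k * v $ k) = (B *v v) $ i"
      by (simp add: matrix_vector_mult_def)
    also have "\<dots> = 0"
      using that(1) by (simp add: Bv S_def)
    finally have "B $ i $ j * v $ j = 0"
      using v B_nonneg by (subst (asm) sum_nonneg_eq_0_iff) (auto simp: prob_simplex_def)
    with that show ?thesis
      by (auto simp: S_def B_def mat_def split: if_splits)
  qed
  moreover have "S \<noteq> UNIV"
    using prob_simplex_nonzero[OF v] by (auto simp: S_def vec_eq_iff)
  ultimately have "S = {}"
    using irr unfolding irreducible_matrix_def by blast
  then have pos: "v $ i > 0" for i
    using v by (metis (mono_tags, lifting) S_def empty_iff mem_Collect_eq order_le_less prob_simplex_def)
  have "A *v v = (\<sigma> v - s) *s v"
    using Bv by (simp add: B_def matrix_vector_mult_add_rdistrib mat_s vec.scale_left_diff_distrib eq_diff_eq)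
  then show ?thesis using that v pos by blast
qed

lemma irreducible_Metzler_positive_subeigenvector:
  fixes A :: "real ^ 'n ^ 'n::finite"
  assumes Metzler: "\<And>i j. i \<noteq> j \<Longrightarrow> A $ i $ j \<ge> 0"
    and irr: "irreducible_matrix A"
  obtains v where "\<And>i. v $ i > 0" "\<And>i. (A *v v) $ i \<le> spectral_abscissa A * v $ i"
proof -
  obtain v r where v: "v \<in> prob_simplex" "\<And>i. v $ i > 0" "A *v v = r *s v"
    using irreducible_Metzler_positive_eigenvector[OF Metzler irr] by blast
  have "r \<le> spectral_abscissa A"
    using real_eigenvalue_le_spectral_abscissa[OF prob_simplex_nonzero[OF v(1)] v(3)] .
  then have "(A *v v) $ i \<le> spectral_abscissa A * v $ i" for i
    using v(2)[of i] by (simp add: v(3))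
  with v(2) that show ?thesis by blast
qed

lemma irreducible_transpose:
  assumes "irreducible_matrix A"
  shows "irreducible_matrix (transpose A)"
  unfolding irreducible_matrix_def
proof
  assume "\<exists>S. S \<noteq> {} \<and> S \<noteq> UNIV \<and> (\<forall>i\<in>S. \<forall>j\<in>- S. transpose A $ i $ j = 0)"
  then obtain S where "S \<noteq> {}" "S \<noteq> UNIV" "\<forall>i\<in>S. \<forall>j\<in>- S. A $ j $ i = 0"
    by (auto simp: transpose_def)
  then have "- S \<noteq> {} \<and> - S \<noteq> UNIV \<and> (\<forall>i\<in>- S. \<forall>j\<in>- (- S). A $ i $ j = 0)"
    by auto
  then have "\<exists>S. S \<noteq> {} \<and> S \<noteq> UNIV \<and> (\<forall>i\<in>S. \<forall>j\<in>- S. A $ i $ j = 0)"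
    by (rule exI)
  with assms show False
    unfolding irreducible_matrix_def by (rule notE)
qed

text \<open>
  Adding \<open>\<delta> > 0\<close> to every entry makes the matrix irreducible and gives a positive \<open>v\<close> in the
  simplex with \<open>A v + \<delta> 1 = l v\<close>, so that \<open>A v \<le> l v\<close>. It remains to choose \<open>\<delta>\<close> with \<open>l < r\<close>. On
  pairs \<open>(v, l)\<close> with \<open>l \<ge> r\<close> the residual \<open>A v - l v\<close> never vanishes, since
  \<open>l\<close> exceeds the spectral abscissa; by compactness its norm has a positive lower bound there.
  The vector found has a residual of size proportional to \<open>\<delta>\<close>, which excludes \<open>l \<ge> r\<close> for small \<open>\<delta>\<close>.
\<close>

lemma Metzler_positive_subeigenvector:
  fixes A :: "real ^ 'n ^ 'n::finite"
  assumes Metzler: "\<And>i j. i \<noteq> j \<Longrightarrow> A $ i $ j \<ge> 0"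
    and r: "r > spectral_abscissa A"
  obtains v where "\<And>i. v $ i > 0" "\<And>i. (A *v v) $ i \<le> r * v $ i"
proof -
  define A' where "A' \<delta> = A + (\<chi> i j. \<delta>)" for \<delta>
  have A'_mult: "A' \<delta> *v v = A *v v + (\<chi> i. \<delta>)" if "v \<in> prob_simplex" for \<delta> v
    using that by (simp add: A'_def matrix_vector_mult_add_rdistrib matrix_vector_mult_def
        vec_eq_iff distrib_right sum.distrib sum_distrib_left[symmetric] prob_simplex_def)
  have perturbed: "\<exists>v\<in>prob_simplex. \<exists>l. (\<forall>i. v $ i > 0) \<and> A *v v + (\<chi> i. \<delta>) = l *s v" if "\<delta> > 0" for \<delta>
  proof -
    have pos: "A' \<delta> $ i $ j > 0" if "i \<noteq> j" for i j
      using Metzler[OF that] \<open>\<delta> > 0\<close> by (simp add: A'_def)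
    have "irreducible_matrix (A' \<delta>)"
      unfolding irreducible_matrix_def
    proof
      assume "\<exists>S. S \<noteq> {} \<and> S \<noteq> UNIV \<and> (\<forall>i\<in>S. \<forall>j\<in>- S. A' \<delta> $ i $ j = 0)"
      then obtain S i j where "i \<in> S" "j \<in> - S" "\<forall>i\<in>S. \<forall>j\<in>- S. A' \<delta> $ i $ j = 0"
        by blast
      then show False using pos[of i j] by (metis ComplD less_irrefl)
    qed
    then show ?thesis
      using irreducible_Metzler_positive_eigenvector[of "A' \<delta>"] pos A'_mult by (metis less_imp_le)
  qed
  \<comment> \<open>\<open>C\<close> bounds the perturbed eigenvalue for \<open>\<delta> \<le> 1\<close>; the maximum keeps \<open>K\<close> nonempty if \<open>C < r\<close>.\<close>
  define C where "C = (\<Sum>i\<in>UNIV. \<Sum>j\<in>UNIV. \<bar>A $ i $ j\<bar>) + real CARD('n)"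
  define K where "K = (prob_simplex :: (real ^ 'n) set) \<times> {r..max r C}"
  define g where "g = (\<lambda>(v, l). norm (A *v v - l *s v))"
  have "compact K"
    unfolding K_def by (intro compact_Times compact_prob_simplex compact_Icc)
  moreover have "K \<noteq> {}"
    using prob_simplex_nonempty by (auto simp: K_def)
  moreover have "continuous_on K g"
    unfolding g_def case_prod_beta matrix_vector_mult_def vector_scalar_mult_def
    by (intro continuous_intros)
  ultimately obtain p where p: "p \<in> K" "\<And>q. q \<in> K \<Longrightarrow> g p \<le> g q"
    using continuous_attains_inf by metis
  have "g p > 0"
  proof -
    obtain v l where vl: "p = (v, l)" "v \<in> prob_simplex" "l \<ge> r"
      using p(1) by (auto simp: K_def)
    then have "A *v v \<noteq> l *s v"
      using real_eigenvalue_le_spectral_abscissa[of v A l] prob_simplex_nonzero r by fastforce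
    then show ?thesis by (simp add: g_def vl)
  qed
  \<comment> \<open>The residual of the perturbed eigenvector has norm at most \<open>\<delta> n\<close>, to be kept below \<open>g p\<close>.\<close>
  define \<delta> where "\<delta> = min 1 (g p / (2 * real CARD('n)))"
  have \<delta>: "\<delta> > 0" "\<delta> \<le> 1" "\<delta> * real CARD('n) < g p"
  proof -
    show "\<delta> > 0" "\<delta> \<le> 1" using \<open>g p > 0\<close> by (simp_all add: \<delta>_def)
    have "\<delta> * real CARD('n) \<le> g p / (2 * real CARD('n)) * real CARD('n)"
      by (intro mult_right_mono) (auto simp: \<delta>_def)
    also have "\<dots> < g p" using \<open>g p > 0\<close> by simp
    finally show "\<delta> * real CARD('n) < g p" .
  qed
  obtain v l where v: "v \<in> prob_simplex" "\<And>i. v $ i > 0" and l: "A *v v + (\<chi> i. \<delta>) = l *s v"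
    using perturbed[OF \<delta>(1)] by blast
  have l_i: "(A *v v) $ i + \<delta> = l * v $ i" for i
    using l by (simp add: vec_eq_iff)
  have "l \<le> C"
  proof -
    have v_le: "v $ j \<le> 1" for j
      using v(1) member_le_sum[of j UNIV "\<lambda>j. v $ j"] by (simp add: prob_simplex_def)
    \<comment> \<open>Sum all components of the eigenvector equation; those of \<open>v\<close> add up to one.\<close>
    have "l = (\<Sum>i\<in>UNIV. l * v $ i)"
      using v(1) by (simp add: prob_simplex_def sum_distrib_left[symmetric])
    also have "\<dots> = (\<Sum>i\<in>UNIV. (A *v v) $ i) + \<delta> * real CARD('n)"
      by (simp add: l_i[symmetric] sum.distrib)
    also have "\<dots> \<le> (\<Sum>i\<in>UNIV. \<Sum>j\<in>UNIV. \<bar>A $ i $ j\<bar>) + real CARD('n)"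
    proof (intro add_mono sum_mono)
      fix i
      have "A $ i $ j * v $ j \<le> \<bar>A $ i $ j\<bar>" for j
      proof -
        have "A $ i $ j * v $ j \<le> \<bar>A $ i $ j\<bar> * v $ j"
          using v(2)[of j] by (intro mult_right_mono) auto
        also have "\<dots> \<le> \<bar>A $ i $ j\<bar>"
          using v_le[of j] by (simp add: mult_left_le)
        finally show ?thesis .
      qed
      then show "(A *v v) $ i \<le> (\<Sum>j\<in>UNIV. \<bar>A $ i $ j\<bar>)"
        by (simp add: matrix_vector_mult_def sum_mono)
    qed (use \<delta> in simp)
    finally show ?thesis by (simp add: C_def)
  qed
  have "l < r"
  proof (rule ccontr)
    assume "\<not> l < r"
    then have "g p \<le> g (v, l)"
      using v(1) \<open>l \<le> C\<close> by (intro p(2)) (auto simp: K_def)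
    also have "\<dots> = norm ((\<chi> i. - \<delta>) :: real ^ 'n)"
      unfolding g_def using l_i by (auto simp: vec_eq_iff algebra_simps intro!: arg_cong[of _ _ norm])
    also have "\<dots> \<le> \<delta> * real CARD('n)"
      using norm_le_l1_cart[of "(\<chi> i. - \<delta>) :: real ^ 'n"] \<delta>(1) by (simp add: mult.commute)
    finally show False using \<delta>(3) by simp
  qed
  have "(A *v v) $ i \<le> r * v $ i" for i
  proof -
    have "(A *v v) $ i \<le> l * v $ i" using l_i[of i] \<delta>(1) by linarith
    also have "\<dots> \<le> r * v $ i" using \<open>l < r\<close> v(2)[of i] by (intro mult_right_mono) auto
    finally show ?thesis .
  qed
  with v(2) that show ?thesis by blast
qed

section \<open>The diagonal Lyapunov inequality\<close>

text \<open>
  Since \<open>d\<^sub>i d\<^sub>j \<le> (d\<^sub>i\<^sup>2 v\<^sub>j / v\<^sub>i + d\<^sub>j\<^sup>2 v\<^sub>i / v\<^sub>j) / 2\<close>, with equality for \<open>i = j\<close>, the possibly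
  negative diagonal entries do no harm. With \<open>\<xi>\<^sub>i = w\<^sub>i / v\<^sub>i\<close>, summing the first
  terms over \<open>j\<close> produces \<open>(A v)\<^sub>i\<close>, and summing the second ones over \<open>i\<close> produces \<open>(A\<^sup>T w)\<^sub>j\<close>.
\<close>

lemma diagonal_Lyapunov_bound:
  fixes A :: "real ^ 'n ^ 'n::finite"
  assumes Metzler: "\<And>i j. i \<noteq> j \<Longrightarrow> A $ i $ j \<ge> 0"
    and v: "\<And>i. v $ i > 0" "\<And>i. (A *v v) $ i \<le> r * v $ i"
    and w: "\<And>i. w $ i > 0" "\<And>i. (transpose A *v w) $ i \<le> r * w $ i"
  shows "(\<Sum>i\<in>UNIV. \<Sum>j\<in>UNIV. w $ i / v $ i * A $ i $ j * d i * d j)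
       \<le> r * (\<Sum>i\<in>UNIV. w $ i / v $ i * (d i)\<^sup>2)"
proof -
  define P where "P i j = w $ i / (v $ i)\<^sup>2 * (d i)\<^sup>2 * (A $ i $ j * v $ j)" for i j
  define Q where "Q i j = (d j)\<^sup>2 / v $ j * (A $ i $ j * w $ i)" for i j
  have AMGM: "w $ i / v $ i * A $ i $ j * d i * d j \<le> (P i j + Q i j) / 2" for i j
  proof -
    have eq: "(P i j + Q i j) / 2 - w $ i / v $ i * A $ i $ j * d i * d j
        = w $ i * A $ i $ j * v $ j / 2 * (d i / v $ i - d j / v $ j)\<^sup>2"
      using v(1)[of i] v(1)[of j] by (simp add: P_def Q_def field_simps power2_eq_square)
    have "\<dots> \<ge> 0"
      using Metzler[of i j] v(1)[of j] w(1)[of i] by (cases "i = j") auto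
    with eq show ?thesis by linarith
  qed
  have "(\<Sum>i\<in>UNIV. \<Sum>j\<in>UNIV. P i j) \<le> (\<Sum>i\<in>UNIV. r * (w $ i / v $ i * (d i)\<^sup>2))"
  proof (rule sum_mono)
    fix i
    have "(\<Sum>j\<in>UNIV. P i j) = w $ i / (v $ i)\<^sup>2 * (d i)\<^sup>2 * (A *v v) $ i"
      by (simp add: P_def matrix_vector_mult_def sum_distrib_left)
    also have "\<dots> \<le> w $ i / (v $ i)\<^sup>2 * (d i)\<^sup>2 * (r * v $ i)"
      using w(1)[of i] by (intro mult_left_mono v) auto
    also have "\<dots> = r * (w $ i / v $ i * (d i)\<^sup>2)"
      using v(1)[of i] by (simp add: field_simps power2_eq_square)
    finally show "(\<Sum>j\<in>UNIV. P i j) \<le> r * (w $ i / v $ i * (d i)\<^sup>2)" .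
  qed
  moreover have "(\<Sum>i\<in>UNIV. \<Sum>j\<in>UNIV. Q i j) \<le> (\<Sum>j\<in>UNIV. r * (w $ j / v $ j * (d j)\<^sup>2))"
  proof (subst sum.swap, rule sum_mono)
    fix j
    have "(\<Sum>i\<in>UNIV. Q i j) = (d j)\<^sup>2 / v $ j * (transpose A *v w) $ j"
      by (simp add: Q_def matrix_vector_mult_def transpose_def sum_distrib_left)
    also have "\<dots> \<le> (d j)\<^sup>2 / v $ j * (r * w $ j)"
      using v(1)[of j] by (intro mult_left_mono w) auto
    finally show "(\<Sum>i\<in>UNIV. Q i j) \<le> r * (w $ j / v $ j * (d j)\<^sup>2)"
      by (simp add: algebra_simps)
  qed
  moreover have "(\<Sum>i\<in>UNIV. \<Sum>j\<in>UNIV. w $ i / v $ i * A $ i $ j * d i * d j)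
      \<le> (\<Sum>i\<in>UNIV. \<Sum>j\<in>UNIV. (P i j + Q i j) / 2)"
    by (intro sum_mono AMGM)
  moreover have "\<dots> = ((\<Sum>i\<in>UNIV. \<Sum>j\<in>UNIV. P i j) + (\<Sum>i\<in>UNIV. \<Sum>j\<in>UNIV. Q i j)) / 2"
    by (simp add: sum_divide_distrib[symmetric] sum.distrib)
  ultimately show ?thesis
    by (simp add: sum_distrib_left)
qed

section \<open>Contraction of the interconnection\<close>

lemma weak_pairing_zero_right:
  assumes "weak_pairing_on V wp" "subspace V" "x \<in> V"
  shows "wp x 0 = 0"
proof -
  have "\<forall>y\<in>V. wp x (0 *\<^sub>R y) = 0 * wp x y"
    using assms unfolding weak_pairing_on_def by blast
  then show ?thesis using subspace_0[OF assms(2)] by auto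
qed

lemma weak_pairing_le_norms:
  assumes "weak_pairing_on V wp" "compatible_on V nrm wp" "norm_on V nrm" "x \<in> V" "y \<in> V"
  shows "wp x y \<le> nrm x * nrm y"
proof -
  have "\<bar>wp x y\<bar> \<le> sqrt (wp x x) * sqrt (wp y y)"
    using assms unfolding weak_pairing_on_def by blast
  then show ?thesis
    using assms by (simp add: compatible_on_def norm_on_def)
qed

lemma osL_leD:
  assumes "osL V nrm wp g \<le> ereal a" "norm_on V nrm" "x \<in> V" "y \<in> V" "x \<noteq> y" "x - y \<in> V"
  shows "wp (g x - g y) (x - y) \<le> a * (nrm (x - y))\<^sup>2"
proof -
  have "ereal (wp (g x - g y) (x - y) / (nrm (x - y))\<^sup>2) \<le> osL V nrm wp g"
    unfolding osL_def using assms by (intro SUP_upper2[of "(x, y)"]) auto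
  then have "wp (g x - g y) (x - y) / (nrm (x - y))\<^sup>2 \<le> a"
    using assms(1) by (meson ereal_less_eq(3) order_trans)
  moreover have "(nrm (x - y))\<^sup>2 > 0"
    using assms by (auto simp: norm_on_def)
  ultimately show ?thesis
    by (simp add: pos_divide_le_eq)
qed

text \<open>
  The increment of the vector field is split at \<open>f i t (y $ i) (others i x)\<close>: the first part
  changes only the own state and is controlled by the one-sided Lipschitz constant, the second
  part changes only the other states and is controlled by the gains.
\<close>

lemma interconnection_pairing_le:
  fixes N :: "'n::finite \<Rightarrow> nat"
    and f :: "'n \<Rightarrow> real \<Rightarrow> fseq \<Rightarrow> fseq ^ 'n \<Rightarrow> fseq"
  assumes f_range: "\<And>u z. u \<in> Rn (N i) \<Longrightarrow> z \<in> others_space N i \<Longrightarrow> f i t u z \<in> Rn (N i)"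
    and norm: "norm_on (Rn (N i)) (nrm i)"
    and pairing: "weak_pairing_on (Rn (N i)) (wp i)"
    and compatible: "compatible_on (Rn (N i)) (nrm i) (wp i)"
    and C1: "\<And>z. z \<in> others_space N i \<Longrightarrow>
             osL (Rn (N i)) (nrm i) (wp i) (\<lambda>u. f i t u z) \<le> ereal (- c i)"
    and C2: "\<And>u y z. u \<in> Rn (N i) \<Longrightarrow> y \<in> others_space N i \<Longrightarrow> z \<in> others_space N i \<Longrightarrow>
             nrm i (f i t u y - f i t u z) \<le> (\<Sum>j\<in>UNIV - {i}. \<gamma> i j * nrm j (y $ j - z $ j))"
    and x: "x \<in> state_space N" and y: "y \<in> state_space N"
  shows "wp i (interconnection f t x $ i - interconnection f t y $ i) (x $ i - y $ i)
       \<le> (\<Sum>j\<in>UNIV. gain_matrix c \<gamma> $ i $ j * nrm i (x $ i - y $ i) * nrm j (x $ j - y $ j))"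
proof -
  let ?V = "Rn (N i)"
  let ?d = "\<lambda>j. nrm j (x $ j - y $ j)"
  let ?u = "f i t (x $ i) (others i x) - f i t (y $ i) (others i x)"
  let ?w = "f i t (y $ i) (others i x) - f i t (y $ i) (others i y)"
  note diff = subspace_diff[OF subspace_Rn]
  have V: "x $ i \<in> ?V" "y $ i \<in> ?V" "x $ i - y $ i \<in> ?V"
    using x y by (auto simp: state_space_def intro: diff)
  note O = others_in_others_space[OF x] others_in_others_space[OF y]
  have uw: "?u \<in> ?V" "?w \<in> ?V"
    using V O by (auto intro!: diff f_range)
  have "interconnection f t x $ i - interconnection f t y $ i = ?u + ?w"
    by (simp add: interconnection_def)
  then have "wp i (interconnection f t x $ i - interconnection f t y $ i) (x $ i - y $ i)
      \<le> wp i ?u (x $ i - y $ i) + wp i ?w (x $ i - y $ i)"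
    using pairing uw V unfolding weak_pairing_on_def by metis
  also have "wp i ?u (x $ i - y $ i) \<le> - c i * (?d i)\<^sup>2"
  \<comment> \<open>\<open>osL\<close> speaks of distinct points only; for equal ones the pairing with \<open>0\<close> vanishes.\<close>
  proof (cases "x $ i = y $ i")
    case True
    moreover have "nrm i 0 = 0"
      using norm subspace_0[OF subspace_Rn, of "N i"] by (simp add: norm_on_def)
    ultimately show ?thesis
      using weak_pairing_zero_right[OF pairing subspace_Rn uw(1)] by simp
  next
    case False
    show ?thesis
      using osL_leD[OF C1[OF O(1)] norm V(1,2) False V(3)] .
  qed
  also have "wp i ?w (x $ i - y $ i) \<le> nrm i ?w * ?d i"
    by (rule weak_pairing_le_norms[OF pairing compatible norm uw(2) V(3)])
  also have "\<dots> \<le> (\<Sum>j\<in>UNIV - {i}. \<gamma> i j * ?d j) * ?d i"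
  proof (rule mult_right_mono)
    have "(\<Sum>j\<in>UNIV - {i}. \<gamma> i j * nrm j (others i x $ j - others i y $ j))
        = (\<Sum>j\<in>UNIV - {i}. \<gamma> i j * ?d j)"
      by (intro sum.cong) (auto simp: others_def)
    then show "nrm i ?w \<le> (\<Sum>j\<in>UNIV - {i}. \<gamma> i j * ?d j)"
      using C2[OF V(2) O] by simp
    show "?d i \<ge> 0"
      using norm V(3) by (simp add: norm_on_def)
  qed
  also have "- c i * (?d i)\<^sup>2 + (\<Sum>j\<in>UNIV - {i}. \<gamma> i j * ?d j) * ?d i
      = (\<Sum>j\<in>UNIV. gain_matrix c \<gamma> $ i $ j * ?d i * ?d j)"
    by (subst sum.remove[of UNIV i])
      (auto simp: gain_matrix_def power2_eq_square sum_distrib_left sum_distrib_right mult_ac intro!: sum.cong)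
  finally show ?thesis by simp
qed

lemma weighted_norm_sq:
  assumes "\<And>i. \<xi> $ i > 0"
  shows "(weighted_norm \<xi> nrm x)\<^sup>2 = (\<Sum>i\<in>UNIV. \<xi> $ i * (nrm i (x $ i))\<^sup>2)"
  unfolding weighted_norm_def
  by (intro real_sqrt_pow2 sum_nonneg mult_nonneg_nonneg) (simp_all add: less_imp_le assms)

text \<open>
  Summing the componentwise bounds with weights \<open>w\<^sub>i / v\<^sub>i\<close> gives the quadratic form of the
  gain matrix at the vector of component distances, to which the diagonal Lyapunov inequality
  applies.
\<close>

lemma strongly_contracting_interconnection:
  fixes N :: "'n::finite \<Rightarrow> nat"
    and f :: "'n \<Rightarrow> real \<Rightarrow> fseq \<Rightarrow> fseq ^ 'n \<Rightarrow> fseq"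
    and v w :: "real ^ 'n"
  defines "\<xi> \<equiv> (\<chi> i. w $ i / v $ i)"
  assumes norm: "\<And>i. norm_on (Rn (N i)) (nrm i)"
    and pairing_le: "\<And>i t x y. t \<ge> 0 \<Longrightarrow> x \<in> state_space N \<Longrightarrow> y \<in> state_space N \<Longrightarrow>
       wp i (interconnection f t x $ i - interconnection f t y $ i) (x $ i - y $ i)
       \<le> (\<Sum>j\<in>UNIV. \<Gamma> $ i $ j * nrm i (x $ i - y $ i) * nrm j (x $ j - y $ j))"
    and Metzler: "\<And>i j. i \<noteq> j \<Longrightarrow> \<Gamma> $ i $ j \<ge> 0"
    and v: "\<And>i. v $ i > 0" "\<And>i. (\<Gamma> *v v) $ i \<le> r * v $ i"
    and w: "\<And>i. w $ i > 0" "\<And>i. (transpose \<Gamma> *v w) $ i \<le> r * w $ i"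
    and r: "r < 0"
  shows "strongly_contracting (state_space N) (weighted_norm \<xi> nrm) (weighted_pairing \<xi> wp)
           (interconnection f) (- r)"
proof -
  have \<xi>: "\<xi> $ i > 0" for i using v(1)[of i] w(1)[of i] by (simp add: \<xi>_def)
  have "weighted_pairing \<xi> wp (interconnection f t x - interconnection f t y) (x - y)
          / (weighted_norm \<xi> nrm (x - y))\<^sup>2 \<le> r"
    if t: "t \<ge> 0" and x: "x \<in> state_space N" and y: "y \<in> state_space N" and "x \<noteq> y" for t x y
  proof -
    let ?d = "\<lambda>i. nrm i (x $ i - y $ i)"
    have V: "x $ i - y $ i \<in> Rn (N i)" for i
      using x y by (auto simp: state_space_def intro: subspace_diff[OF subspace_Rn])
    obtain k where "x $ k \<noteq> y $ k"
      using \<open>x \<noteq> y\<close> by (auto simp: vec_eq_iff)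
    then have "?d k \<noteq> 0"
      using norm[of k] V[of k] by (auto simp: norm_on_def)
    then have "0 < \<xi> $ k * (?d k)\<^sup>2"
      using \<xi>[of k] by simp
    also have "\<dots> \<le> (\<Sum>i\<in>UNIV. \<xi> $ i * (?d i)\<^sup>2)"
      using \<xi> by (intro member_le_sum[of k UNIV "\<lambda>i. \<xi> $ i * (?d i)\<^sup>2"]) (auto simp: less_imp_le)
    also have norm_eq: "\<dots> = (weighted_norm \<xi> nrm (x - y))\<^sup>2"
      by (simp add: weighted_norm_sq[OF \<xi>])
    finally have pos: "0 < (weighted_norm \<xi> nrm (x - y))\<^sup>2" .
    have "weighted_pairing \<xi> wp (interconnection f t x - interconnection f t y) (x - y)
        \<le> (\<Sum>i\<in>UNIV. \<xi> $ i * (\<Sum>j\<in>UNIV. \<Gamma> $ i $ j * ?d i * ?d j))"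
      unfolding weighted_pairing_def
      by (intro sum_mono mult_left_mono) (simp_all add: pairing_le[OF t x y] less_imp_le[OF \<xi>])
    also have "\<dots> = (\<Sum>i\<in>UNIV. \<Sum>j\<in>UNIV. w $ i / v $ i * \<Gamma> $ i $ j * ?d i * ?d j)"
      by (simp add: \<xi>_def sum_distrib_left mult.assoc)
    also have "\<dots> \<le> r * (\<Sum>i\<in>UNIV. w $ i / v $ i * (?d i)\<^sup>2)"
      by (rule diagonal_Lyapunov_bound[OF Metzler v w])
    also have "\<dots> = r * (weighted_norm \<xi> nrm (x - y))\<^sup>2"
      using norm_eq by (simp add: \<xi>_def)
    finally show ?thesis
      using pos by (simp add: pos_divide_le_eq)
  qed
  then show ?thesis
    using r unfolding strongly_contracting_def osL_def by (auto intro!: SUP_least)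
qed

text \<open>
  Subeigenvectors for \<open>r = \<alpha>(\<Gamma>) + \<epsilon>\<close> and, in the irreducible case, for \<open>r = \<alpha>(\<Gamma>)\<close> give the two
  parts; both values are negative, so the rate \<open>\<bar>r\<bar>\<close> is \<open>-r\<close>.
\<close>

theorem theorem41:
  fixes N :: "'n::finite \<Rightarrow> nat"
    and f :: "'n \<Rightarrow> real \<Rightarrow> fseq \<Rightarrow> fseq ^ 'n \<Rightarrow> fseq"
    and nrm :: "'n \<Rightarrow> fseq \<Rightarrow> real"
    and wp :: "'n \<Rightarrow> fseq \<Rightarrow> fseq \<Rightarrow> real"
    and c :: "'n \<Rightarrow> real"
    and \<gamma> :: "'n \<Rightarrow> 'n \<Rightarrow> real"
    and \<Gamma> :: "real ^ 'n ^ 'n"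
  assumes f_range: "\<And>i t u z. t \<ge> 0 \<Longrightarrow> u \<in> Rn (N i) \<Longrightarrow> z \<in> others_space N i \<Longrightarrow>
             f i t u z \<in> Rn (N i)"
    and f_cont: "\<And>i. continuous_on ({0..} \<times> Rn (N i) \<times> others_space N i)
             (\<lambda>(t, u, z). f i t u z)"
    and norm: "\<And>i. norm_on (Rn (N i)) (nrm i)"
    and pairing: "\<And>i. weak_pairing_on (Rn (N i)) (wp i)"
    and compatible: "\<And>i. compatible_on (Rn (N i)) (nrm i) (wp i)"
    and deimling: "\<And>i. deimling_on (Rn (N i)) (nrm i) (wp i)"
    and curve: "\<And>i. curve_norm_derivative_on (Rn (N i)) (nrm i) (wp i)"
    and c_pos: "\<And>i. c i > 0"
    and gamma_nonneg: "\<And>i j. i \<noteq> j \<Longrightarrow> \<gamma> i j \<ge> 0"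
    and C1: "\<And>i t z. t \<ge> 0 \<Longrightarrow> z \<in> others_space N i \<Longrightarrow>
             osL (Rn (N i)) (nrm i) (wp i) (\<lambda>u. f i t u z) \<le> ereal (- c i)"
    and C2: "\<And>i t u y z. t \<ge> 0 \<Longrightarrow> u \<in> Rn (N i) \<Longrightarrow>
             y \<in> others_space N i \<Longrightarrow> z \<in> others_space N i \<Longrightarrow>
             nrm i (f i t u y - f i t u z) \<le> (\<Sum>j\<in>UNIV - {i}. \<gamma> i j * nrm j (y $ j - z $ j))"
    and Gamma_def: "\<Gamma> = gain_matrix c \<gamma>"
    and Hurwitz: "Hurwitz \<Gamma>"
  shows "(\<forall>\<epsilon>. 0 < \<epsilon> \<and> \<epsilon> < \<bar>spectral_abscissa \<Gamma>\<bar> \<longrightarrow>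
            (\<exists>\<xi>::real ^ 'n. (\<forall>i. \<xi> $ i > 0) \<and>
               strongly_contracting (state_space N) (weighted_norm \<xi> nrm) (weighted_pairing \<xi> wp)
                 (interconnection f) \<bar>spectral_abscissa \<Gamma> + \<epsilon>\<bar>)) \<and>
         (irreducible_matrix \<Gamma> \<longrightarrow>
            (\<exists>\<xi>::real ^ 'n. (\<forall>i. \<xi> $ i > 0) \<and>
               strongly_contracting (state_space N) (weighted_norm \<xi> nrm) (weighted_pairing \<xi> wp)
                 (interconnection f) \<bar>spectral_abscissa \<Gamma>\<bar>))"
proof -
  have Metzler: "\<Gamma> $ i $ j \<ge> 0" if "i \<noteq> j" for i j
    using that gamma_nonneg by (simp add: Gamma_def gain_matrix_def)
  have Metzler': "transpose \<Gamma> $ i $ j \<ge> 0" if "i \<noteq> j" for i j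
    using that Metzler by (simp add: transpose_def)
  have abscissa': "spectral_abscissa (transpose \<Gamma>) = spectral_abscissa \<Gamma>"
    by (simp add: spectral_abscissa_def eigenvalues_transpose)
  have contracting: "\<exists>\<xi>::real ^ 'n. (\<forall>i. \<xi> $ i > 0) \<and>
      strongly_contracting (state_space N) (weighted_norm \<xi> nrm) (weighted_pairing \<xi> wp)
        (interconnection f) \<bar>r\<bar>"
    if v: "\<And>i. v $ i > 0" "\<And>i. (\<Gamma> *v v) $ i \<le> r * v $ i"
      and w: "\<And>i. w $ i > 0" "\<And>i. (transpose \<Gamma> *v w) $ i \<le> r * w $ i"
      and r: "r < 0" for v w r
  proof -
    have "strongly_contracting (state_space N) (weighted_norm (\<chi> i. w $ i / v $ i) nrm)
        (weighted_pairing (\<chi> i. w $ i / v $ i) wp) (interconnection f) (- r)"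
    proof (rule strongly_contracting_interconnection[OF norm _ Metzler v w r])
      fix i t x y assume txy: "t \<ge> (0::real)" "x \<in> state_space N" "y \<in> state_space N"
      show "wp i (interconnection f t x $ i - interconnection f t y $ i) (x $ i - y $ i)
          \<le> (\<Sum>j\<in>UNIV. \<Gamma> $ i $ j * nrm i (x $ i - y $ i) * nrm j (x $ j - y $ j))"
        unfolding Gamma_def
        by (rule interconnection_pairing_le[OF _ norm pairing compatible _ _ txy(2,3)])
          (simp_all add: f_range C1 C2 txy(1))
    qed
    then show ?thesis
      using v(1) w(1) r by (intro exI[of _ "\<chi> i. w $ i / v $ i"]) simp
  qed
  show ?thesis
  proof (intro conjI allI impI)
    fix \<epsilon> assume \<epsilon>: "0 < \<epsilon> \<and> \<epsilon> < \<bar>spectral_abscissa \<Gamma>\<bar>"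
    let ?r = "spectral_abscissa \<Gamma> + \<epsilon>"
    obtain v where v: "\<And>i. v $ i > 0" "\<And>i. (\<Gamma> *v v) $ i \<le> ?r * v $ i"
      using Metzler_positive_subeigenvector[of \<Gamma> ?r] Metzler \<epsilon> by auto
    obtain w where w: "\<And>i. w $ i > 0" "\<And>i. (transpose \<Gamma> *v w) $ i \<le> ?r * w $ i"
      using Metzler_positive_subeigenvector[of "transpose \<Gamma>" ?r] Metzler' abscissa' \<epsilon> by auto
    show "\<exists>\<xi>::real ^ 'n. (\<forall>i. \<xi> $ i > 0) \<and>
        strongly_contracting (state_space N) (weighted_norm \<xi> nrm) (weighted_pairing \<xi> wp)
          (interconnection f) \<bar>?r\<bar>"
      using \<epsilon> Hurwitz by (intro contracting[OF v w]) (auto simp: Hurwitz_def)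
  next
    assume irr: "irreducible_matrix \<Gamma>"
    obtain v where v: "\<And>i. v $ i > 0" "\<And>i. (\<Gamma> *v v) $ i \<le> spectral_abscissa \<Gamma> * v $ i"
      using irreducible_Metzler_positive_subeigenvector[OF Metzler irr] by blast
    obtain w where w: "\<And>i. w $ i > 0"
        "\<And>i. (transpose \<Gamma> *v w) $ i \<le> spectral_abscissa \<Gamma> * w $ i"
      using irreducible_Metzler_positive_subeigenvector[OF Metzler' irreducible_transpose[OF irr],
          unfolded abscissa'] by blast
    show "\<exists>\<xi>::real ^ 'n. (\<forall>i. \<xi> $ i > 0) \<and>
        strongly_contracting (state_space N) (weighted_norm \<xi> nrm) (weighted_pairing \<xi> wp)
          (interconnection f) \<bar>spectral_abscissa \<Gamma>\<bar>"
      using Hurwitz by (intro contracting[OF v w]) (auto simp: Hurwitz_def)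
  qed
qed

end
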